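(* Let (Or) $x\lor_s y=\neg(\neg x\land_s\neg y)$, (Abs) $x\land_s(x\lor_s y)=x$, (Mem) $(x\lor_s y)\land_s z=(\neg x\land_s(y\land_s z))\lor_s(x\land_s z)$ and (Comm) $x\land_s y=y\land_s x$. From these four equations the following are derivable in equational logic: $x\land_s x=x$, $x\lor_s x=x$, $(x\land_s y)\land_s z=x\land_s(y\land_s z)$, $(x\lor_s y)\lor_s z=x\lor_s(y\lor_s z)$, $\neg\neg x=x$, (Tdef) $(x\lor_s\neg x)\land_s y=y$, and (LD) $x\land_s(y\lor_s z)=(x\land_s y)\lor_s(x\land_s z)$. Furthermore, if $|A|\ge 2$, these four equations (Or), (Abs), (Mem), (Comm) are independent: none is derivable from the other three.
   Context: $A$ is a non-empty set of atoms; terms are over $\Sigma_{SCL}(A)=\{\land_s,\lor_s,\neg,\mathsf T,\mathsf F\}\cup A$ (atoms and $\mathsf T,\mathsf F$ constants, $\neg$ unary, $\land_s,\lor_s$ binary sequential conjunction/disjunction) with variables. *)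

theory Defs
  imports Main
begin

(* The set A of atoms is the type 'a, non-empty like every type; the variables are the
   countably many Var n, so that terms are open. Atoms and T, F are constants: substitution
   leaves them fixed. *)
datatype 'a scl =
    Var nat
  | Atom 'a
  | Tt ("\<^bold>T")
  | Ff ("\<^bold>F")
  | Neg "'a scl" ("\<^bold>\<not> _" [90] 90)
  | Conj "'a scl" "'a scl" (infixr "\<and>\<^sub>s" 75)
  | Disj "'a scl" "'a scl" (infixr "\<or>\<^sub>s" 70)

type_synonym 'a eqn = "'a scl \<times> 'a scl"

abbreviation eqn :: "'a scl \<Rightarrow> 'a scl \<Rightarrow> 'a eqn" (infix "\<approx>" 50) where
  "s \<approx> t \<equiv> (s, t)"

primrec subst :: "(nat \<Rightarrow> 'a scl) \<Rightarrow> 'a scl \<Rightarrow> 'a scl" where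
  "subst \<sigma> (Var n) = \<sigma> n"
| "subst \<sigma> (Atom a) = Atom a"
| "subst \<sigma> \<^bold>T = \<^bold>T"
| "subst \<sigma> \<^bold>F = \<^bold>F"
| "subst \<sigma> (\<^bold>\<not> s) = \<^bold>\<not> (subst \<sigma> s)"
| "subst \<sigma> (s \<and>\<^sub>s t) = subst \<sigma> s \<and>\<^sub>s subst \<sigma> t"
| "subst \<sigma> (s \<or>\<^sub>s t) = subst \<sigma> s \<or>\<^sub>s subst \<sigma> t"

inductive derivable :: "'a eqn set \<Rightarrow> 'a eqn \<Rightarrow> bool" (infix "\<turnstile>" 45) for E :: "'a eqn set" where
  ax: "e \<in> E \<Longrightarrow> E \<turnstile> e"
| refl: "E \<turnstile> s \<approx> s"
| sym: "E \<turnstile> s \<approx> t \<Longrightarrow> E \<turnstile> t \<approx> s"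
| trans: "E \<turnstile> s \<approx> t \<Longrightarrow> E \<turnstile> t \<approx> u \<Longrightarrow> E \<turnstile> s \<approx> u"
| subst: "E \<turnstile> s \<approx> t \<Longrightarrow> E \<turnstile> subst \<sigma> s \<approx> subst \<sigma> t"
| cong_Neg: "E \<turnstile> s \<approx> t \<Longrightarrow> E \<turnstile> \<^bold>\<not> s \<approx> \<^bold>\<not> t"
| cong_Conj: "E \<turnstile> s \<approx> t \<Longrightarrow> E \<turnstile> s' \<approx> t' \<Longrightarrow> E \<turnstile> s \<and>\<^sub>s s' \<approx> t \<and>\<^sub>s t'"
| cong_Disj: "E \<turnstile> s \<approx> t \<Longrightarrow> E \<turnstile> s' \<approx> t' \<Longrightarrow> E \<turnstile> s \<or>\<^sub>s s' \<approx> t \<or>\<^sub>s t'"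

abbreviation vx :: "'a scl" where "vx \<equiv> Var 0"
abbreviation vy :: "'a scl" where "vy \<equiv> Var 1"
abbreviation vz :: "'a scl" where "vz \<equiv> Var 2"

definition Or :: "'a eqn" where
  "Or = (vx \<or>\<^sub>s vy \<approx> \<^bold>\<not> (\<^bold>\<not> vx \<and>\<^sub>s \<^bold>\<not> vy))"

definition Abs :: "'a eqn" where
  "Abs = (vx \<and>\<^sub>s (vx \<or>\<^sub>s vy) \<approx> vx)"

definition Mem :: "'a eqn" where
  "Mem = ((vx \<or>\<^sub>s vy) \<and>\<^sub>s vz \<approx> (\<^bold>\<not> vx \<and>\<^sub>s (vy \<and>\<^sub>s vz)) \<or>\<^sub>s (vx \<and>\<^sub>s vz))"

definition Comm :: "'a eqn" where
  "Comm = (vx \<and>\<^sub>s vy \<approx> vy \<and>\<^sub>s vx)"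

end

(* Soundness of equational logic reduces the independence claims to four countermodels. For the
   derivability claims it suffices to reason in the algebra of terms modulo derivable equality.
   There (Mem) makes conjunction idempotent and monotone with respect to the relation
   x = x \<sqinter> y, and together with (Or) and (Abs) it forces double negation; the axioms are then
   self-dual. Monotonicity and its dual make the relation a partial order with \<sqinter> as meet and
   \<squnion> as join, which gives associativity, and (Mem) supplies the nontrivial half of
   distributivity. *)
theory Submission
  imports Defs
begin

section \<open>Algebras satisfying the four equations\<close>

locale static_algebra =
  fixes conj :: "'b \<Rightarrow> 'b \<Rightarrow> 'b" (infixl "\<sqinter>" 75)
    and disj :: "'b \<Rightarrow> 'b \<Rightarrow> 'b" (infixl "\<squnion>" 70)
    and neg :: "'b \<Rightarrow> 'b" ("\<sim> _" [90] 90)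
  assumes disj_def: "x \<squnion> y = \<sim> (\<sim> x \<sqinter> \<sim> y)"
    and conj_absorb: "x \<sqinter> (x \<squnion> y) = x"
    and memorize: "(x \<squnion> y) \<sqinter> z = (\<sim> x \<sqinter> (y \<sqinter> z)) \<squnion> (x \<sqinter> z)"
    and conj_commute: "x \<sqinter> y = y \<sqinter> x"
begin

section \<open>Absorption and double negation\<close>

lemma disj_commute: "x \<squnion> y = y \<squnion> x"
  by (simp add: disj_def conj_commute)

text \<open>By (Mem), \<open>(x \<squnion> y) \<sqinter> z\<close> is a disjunction with
  \<open>x \<sqinter> z\<close> as a disjunct, so (Abs) applies.\<close>

lemma conj_mono_disj: "(x \<sqinter> z) \<sqinter> ((x \<squnion> y) \<sqinter> z) = x \<sqinter> z"
  unfolding memorize by (metis conj_absorb disj_commute)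

text \<open>The instance of \<open>conj_mono_disj\<close> in which absorption collapses
  \<open>(y \<squnion> x) \<sqinter> x\<close> to \<open>x\<close>.\<close>

lemma conj_conj_absorb: "x \<sqinter> (x \<sqinter> y) = x \<sqinter> y"
  by (metis conj_mono_disj conj_absorb conj_commute disj_commute)

lemma conj_idem: "x \<sqinter> x = x"
  by (metis conj_conj_absorb conj_absorb)

text \<open>Absorption up to a double negation, which \<open>neg_neg\<close> later removes.\<close>

lemma disj_conj_eq_neg_neg: "y \<squnion> (x \<sqinter> y) = \<sim> \<sim> y"
proof -
  \<comment> \<open>(Mem) splits \<open>y\<close> into cases on \<open>x\<close>, since
    \<open>(x \<squnion> y) \<sqinter> y\<close> collapses to \<open>y\<close>.\<close>
  have "y = (\<sim> x \<sqinter> y) \<squnion> (x \<sqinter> y)"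
    using memorize[of x y y] by (metis conj_absorb conj_commute disj_commute conj_idem)
  then have "\<sim> y \<sqinter> \<sim> (x \<sqinter> y) = \<sim> y"
    by (metis disj_def conj_absorb memorize conj_conj_absorb conj_commute)
  then show ?thesis
    by (simp add: disj_def)
qed

text \<open>By (Or) and idempotence, \<open>x \<squnion> x\<close> is
  \<open>\<sim> \<sim> x\<close>. Its conjunction with \<open>x\<close> is therefore
  \<open>\<sim> \<sim> x\<close> by (Mem) and \<open>x\<close> by (Abs).\<close>

lemma neg_neg: "\<sim> \<sim> x = x"
proof -
  have "\<sim> \<sim> x \<sqinter> x = \<sim> \<sim> (x \<sqinter> x)"
    using memorize[of x x x] disj_conj_eq_neg_neg[of "x \<sqinter> x" "\<sim> x"]
    by (simp add: disj_def[of x x] conj_idem disj_commute)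
  moreover have "x \<sqinter> \<sim> \<sim> x = x"
    using conj_absorb[of x x] by (simp add: disj_def conj_idem)
  ultimately show ?thesis
    by (simp add: conj_idem conj_commute)
qed

lemma neg_disj: "\<sim> (x \<squnion> y) = \<sim> x \<sqinter> \<sim> y"
  by (simp add: disj_def neg_neg)

lemma neg_conj: "\<sim> (x \<sqinter> y) = \<sim> x \<squnion> \<sim> y"
  by (simp add: disj_def neg_neg)

lemma disj_conj_absorb: "x \<squnion> (x \<sqinter> y) = x"
  using disj_conj_eq_neg_neg by (simp add: neg_neg conj_commute)

section \<open>The order, duality and the lattice laws\<close>

definition le :: "'b \<Rightarrow> 'b \<Rightarrow> bool" (infix "\<sqsubseteq>" 50) where
  "x \<sqsubseteq> y \<longleftrightarrow> x \<sqinter> y = x"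

lemma le_iff_disj: "x \<sqsubseteq> y \<longleftrightarrow> x \<squnion> y = y"
  unfolding le_def by (metis conj_absorb disj_conj_absorb conj_commute disj_commute)

lemma le_antisym: "x \<sqsubseteq> y \<Longrightarrow> y \<sqsubseteq> x \<Longrightarrow> x = y"
  by (metis le_def conj_commute)

lemma conj_mono: "x \<sqsubseteq> y \<Longrightarrow> x \<sqinter> z \<sqsubseteq> y \<sqinter> z"
  by (metis le_def le_iff_disj conj_mono_disj)

text \<open>Makes the dual of every lemma available, in particular idempotence and associativity of
  disjunction.\<close>

sublocale dual: static_algebra disj conj neg
proof
  show "x \<sqinter> y = \<sim> (\<sim> x \<squnion> \<sim> y)" for x y
    by (simp add: disj_def neg_neg)
  show "x \<squnion> (x \<sqinter> y) = x" for x y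
    by (rule disj_conj_absorb)
  show "(x \<sqinter> y) \<squnion> z = (\<sim> x \<squnion> (y \<squnion> z)) \<sqinter> (x \<squnion> z)" for x y z
    using arg_cong[OF memorize[of "\<sim> x" "\<sim> y" "\<sim> z"], of neg]
    by (simp add: neg_disj neg_conj neg_neg)
  show "x \<squnion> y = y \<squnion> x" for x y
    by (rule disj_commute)
qed

text \<open>(Mem) expands the left side and \<open>(x \<squnion> y) \<sqinter> y\<close> to the same
  case split on \<open>x\<close>; the latter is \<open>y\<close> by absorption.\<close>

lemma excluded_middle_conj: "(x \<squnion> \<sim> x) \<sqinter> y = y"
proof -
  have "(x \<squnion> \<sim> x) \<sqinter> y = (\<sim> x \<sqinter> y) \<squnion> (x \<sqinter> y)"
    by (simp add: memorize conj_conj_absorb)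
  also have "\<dots> = (x \<squnion> y) \<sqinter> y"
    by (simp add: memorize conj_idem)
  also have "\<dots> = y"
    by (metis conj_absorb conj_commute disj_commute)
  finally show ?thesis .
qed

lemma dual_le: "dual.le x y \<longleftrightarrow> y \<sqsubseteq> x"
  by (simp add: dual.le_def le_iff_disj disj_commute)

lemma disj_mono: "x \<sqsubseteq> y \<Longrightarrow> x \<squnion> z \<sqsubseteq> y \<squnion> z"
  using dual.conj_mono by (simp add: dual_le)

text \<open>Associativity is not yet available. Instead, \<open>disj_mono\<close> gives
  \<open>x \<squnion> z \<sqsubseteq> z\<close>, and absorption turns this into equality.\<close>

lemma le_trans: "x \<sqsubseteq> y \<Longrightarrow> y \<sqsubseteq> z \<Longrightarrow> x \<sqsubseteq> z"
  by (metis disj_mono le_iff_disj le_def conj_absorb conj_commute disj_commute)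

lemma conj_le1: "x \<sqinter> y \<sqsubseteq> x"
  by (metis le_def conj_conj_absorb conj_commute)

lemma conj_le2: "x \<sqinter> y \<sqsubseteq> y"
  by (metis conj_le1 conj_commute)

lemma disj_ge1: "x \<sqsubseteq> x \<squnion> y"
  by (simp add: le_def conj_absorb)

lemma disj_ge2: "y \<sqsubseteq> x \<squnion> y"
  by (metis disj_ge1 disj_commute)

lemma conj_greatest: "w \<sqsubseteq> x \<Longrightarrow> w \<sqsubseteq> y \<Longrightarrow> w \<sqsubseteq> x \<sqinter> y"
  by (metis conj_mono le_trans conj_idem conj_commute)

lemma disj_least: "x \<sqsubseteq> w \<Longrightarrow> y \<sqsubseteq> w \<Longrightarrow> x \<squnion> y \<sqsubseteq> w"
  by (metis disj_mono le_trans dual.conj_idem disj_commute)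

lemma conj_assoc: "(x \<sqinter> y) \<sqinter> z = x \<sqinter> (y \<sqinter> z)"
  by (meson le_antisym conj_greatest conj_le1 conj_le2 le_trans)

lemma conj_disj_distrib: "x \<sqinter> (y \<squnion> z) = (x \<sqinter> y) \<squnion> (x \<sqinter> z)"
proof (rule le_antisym)
  \<comment> \<open>(Mem) and commutativity identify the left side with
    \<open>x \<sqinter> (y \<squnion> z)\<close>; dropping the factor \<open>\<sim> y\<close> can
    only enlarge it.\<close>
  have "(\<sim> y \<sqinter> (z \<sqinter> x)) \<squnion> (y \<sqinter> x) \<sqsubseteq> (z \<sqinter> x) \<squnion> (y \<sqinter> x)"
    by (intro disj_mono conj_le2)
  then show "x \<sqinter> (y \<squnion> z) \<sqsubseteq> (x \<sqinter> y) \<squnion> (x \<sqinter> z)"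
    by (metis memorize conj_commute disj_commute)
  show "(x \<sqinter> y) \<squnion> (x \<sqinter> z) \<sqsubseteq> x \<sqinter> (y \<squnion> z)"
    by (meson disj_least conj_greatest conj_le1 conj_le2 disj_ge1 disj_ge2 le_trans)
qed

end

section \<open>The algebra of terms modulo derivable equality\<close>

abbreviation static_axioms :: "'a eqn set" where
  "static_axioms \<equiv> {Or, Abs, Mem, Comm}"

quotient_type 'a static_term = "'a scl" / "\<lambda>s t :: 'a scl. static_axioms \<turnstile> s \<approx> t"
  by (intro equivpI reflpI sympI transpI)
    (rule derivable.refl, erule derivable.sym, erule (1) derivable.trans)

lift_definition tconj :: "'a static_term \<Rightarrow> 'a static_term \<Rightarrow> 'a static_term" is Conj
  by (rule derivable.cong_Conj)

lift_definition tdisj :: "'a static_term \<Rightarrow> 'a static_term \<Rightarrow> 'a static_term" is Disj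
  by (rule derivable.cong_Disj)

lift_definition tneg :: "'a static_term \<Rightarrow> 'a static_term" is Neg
  by (rule derivable.cong_Neg)

text \<open>The nested \<open>case_nat\<close> sends \<open>vx\<close> to \<open>u\<close>,
  \<open>vy\<close> to \<open>v\<close> and \<open>vz\<close> to \<open>w\<close>, so axioms can be
  used at arbitrary terms.\<close>

lemma derivable_instance:
  assumes "e \<in> E"
  shows "E \<turnstile> subst (case_nat u (case_nat v (\<lambda>_. w))) (fst e) \<approx>
    subst (case_nat u (case_nat v (\<lambda>_. w))) (snd e)"
  using assms by (intro derivable.subst derivable.ax) simp

interpretation static_term: static_algebra tconj tdisj tneg
proof
  fix x y z :: "'a static_term"
  show "tdisj x y = tneg (tconj (tneg x) (tneg y))"
  proof transfer
    fix u v :: "'a scl"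
    show "static_axioms \<turnstile> u \<or>\<^sub>s v \<approx> \<^bold>\<not> (\<^bold>\<not> u \<and>\<^sub>s \<^bold>\<not> v)"
      using derivable_instance[of Or static_axioms u v v] by (simp add: Or_def numeral_2_eq_2)
  qed
  show "tconj x (tdisj x y) = x"
  proof transfer
    fix u v :: "'a scl"
    show "static_axioms \<turnstile> u \<and>\<^sub>s (u \<or>\<^sub>s v) \<approx> u"
      using derivable_instance[of Abs static_axioms u v v] by (simp add: Abs_def numeral_2_eq_2)
  qed
  show "tconj (tdisj x y) z = tdisj (tconj (tneg x) (tconj y z)) (tconj x z)"
  proof transfer
    fix u v w :: "'a scl"
    show "static_axioms \<turnstile> (u \<or>\<^sub>s v) \<and>\<^sub>s w \<approx> (\<^bold>\<not> u \<and>\<^sub>s (v \<and>\<^sub>s w)) \<or>\<^sub>s (u \<and>\<^sub>s w)"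
      using derivable_instance[of Mem static_axioms u v w] by (simp add: Mem_def numeral_2_eq_2)
  qed
  show "tconj x y = tconj y x"
  proof transfer
    fix u v :: "'a scl"
    show "static_axioms \<turnstile> u \<and>\<^sub>s v \<approx> v \<and>\<^sub>s u"
      using derivable_instance[of Comm static_axioms u v v] by (simp add: Comm_def numeral_2_eq_2)
  qed
qed

text \<open>Rewriting with these turns a derivability goal into an identity in the quotient, with
  the abstraction pushed down to the variables.\<close>

lemmas derivable_iff_static_term_eq =
  static_term.abs_eq_iff[symmetric] tconj.abs_eq[symmetric] tdisj.abs_eq[symmetric]
  tneg.abs_eq[symmetric]

section \<open>Soundness and countermodels\<close>

(* All constants, atoms included, are interpreted by the same element k; this suffices for the
   countermodels because they refute open equations. *)
primrec eval :: "'b \<Rightarrow> ('b \<Rightarrow> 'b) \<Rightarrow> ('b \<Rightarrow> 'b \<Rightarrow> 'b) \<Rightarrow> ('b \<Rightarrow> 'b \<Rightarrow> 'b) \<Rightarrow>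
    (nat \<Rightarrow> 'b) \<Rightarrow> 'a scl \<Rightarrow> 'b" where
  "eval k n c d \<rho> (Var i) = \<rho> i"
| "eval k n c d \<rho> (Atom a) = k"
| "eval k n c d \<rho> \<^bold>T = k"
| "eval k n c d \<rho> \<^bold>F = k"
| "eval k n c d \<rho> (\<^bold>\<not> s) = n (eval k n c d \<rho> s)"
| "eval k n c d \<rho> (s \<and>\<^sub>s t) = c (eval k n c d \<rho> s) (eval k n c d \<rho> t)"
| "eval k n c d \<rho> (s \<or>\<^sub>s t) = d (eval k n c d \<rho> s) (eval k n c d \<rho> t)"

lemma eval_subst: "eval k n c d \<rho> (subst \<sigma> s) = eval k n c d (\<lambda>i. eval k n c d \<rho> (\<sigma> i)) s"
  by (induction s) simp_all

lemma soundness: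
  assumes "E \<turnstile> e"
    and "\<forall>e\<in>E. \<forall>\<rho>. eval k n c d \<rho> (fst e) = eval k n c d \<rho> (snd e)"
  shows "eval k n c d \<rho> (fst e) = eval k n c d \<rho> (snd e)"
  using assms(1)
\<comment> \<open>The valuation varies because the substitution case replaces it, by
  \<open>eval_subst\<close>.\<close>
proof (induction arbitrary: \<rho>)
  case (ax e)
  then show ?case using assms(2) by simp
qed (simp_all add: eval_subst)

lemma underivable_if_countermodel:
  assumes "\<forall>e\<in>E. \<forall>\<rho>. eval k n c d \<rho> (fst e) = eval k n c d \<rho> (snd e)"
    and "eval k n c d \<rho> (fst e) \<noteq> eval k n c d \<rho> (snd e)"
  shows "\<not> E \<turnstile> e"
  using soundness[OF _ assms(1)] assms(2) by blast

text \<open>With negation constantly true on the Booleans, (Mem) becomes distributivity, but (Or)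
  fails at false arguments.\<close>

lemma Or_independent: "\<not> {Abs, Mem, Comm :: 'a eqn} \<turnstile> Or"
  by (rule underivable_if_countermodel[of _ True "\<lambda>_. True" "(\<and>)" "(\<or>)" "\<lambda>_. False"])
    (auto simp: Or_def Abs_def Mem_def Comm_def)

text \<open>All operations are constantly false, which refutes only an equation with a bare variable
  as one side.\<close>

lemma Abs_independent: "\<not> {Or, Mem, Comm :: 'a eqn} \<turnstile> Abs"
  by (rule underivable_if_countermodel[of _ False "\<lambda>_. False" "\<lambda>_ _. False" "\<lambda>_ _. False" "\<lambda>_. True"])
    (auto simp: Or_def Abs_def Mem_def Comm_def)

text \<open>With negation and disjunction constantly true, (Abs) holds because truth is a unit of
  conjunction, whereas (Mem) would make every \<open>z\<close> true.\<close>

lemma Mem_independent: "\<not> {Or, Abs, Comm :: 'a eqn} \<turnstile> Mem"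
  by (rule underivable_if_countermodel[of _ True "\<lambda>_. True" "(\<and>)" "\<lambda>_ _. True" "\<lambda>_. False"])
    (auto simp: Or_def Abs_def Mem_def Comm_def)

(* McCarthy's three-valued logic, with None as the undefined value. *)
definition mccarthy_conj :: "bool option \<Rightarrow> bool option \<Rightarrow> bool option" where
  "mccarthy_conj x y = (if x = Some True then y else x)"

definition mccarthy_disj :: "bool option \<Rightarrow> bool option \<Rightarrow> bool option" where
  "mccarthy_disj x y = (if x = Some False then y else x)"

lemma Comm_independent: "\<not> {Or, Abs, Mem :: 'a eqn} \<turnstile> Comm"
proof -
  have "mccarthy_disj x y =
      map_option Not (mccarthy_conj (map_option Not x) (map_option Not y))"
    and "mccarthy_conj x (mccarthy_disj x y) = x"
    and "mccarthy_conj (mccarthy_disj x y) z =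
      mccarthy_disj (mccarthy_conj (map_option Not x) (mccarthy_conj y z)) (mccarthy_conj x z)"
    for x y z
    by (cases x; auto simp: mccarthy_conj_def mccarthy_disj_def option.map_comp comp_def option.map_ident)+
  \<comment> \<open>An undefined left argument blocks evaluation, while a false one short-circuits
    it.\<close>
  moreover have "mccarthy_conj None (Some False) \<noteq> mccarthy_conj (Some False) None"
    by (simp add: mccarthy_conj_def)
  ultimately show ?thesis
    by (intro underivable_if_countermodel[of _ None "map_option Not" mccarthy_conj mccarthy_disj
          "case_nat None (\<lambda>_. Some False)"])
      (simp_all add: Or_def Abs_def Mem_def Comm_def)
qed

theorem theorem6p1:
  shows
    "{Or, Abs, Mem, Comm :: 'a eqn} \<turnstile> vx \<and>\<^sub>s vx \<approx> vx \<and>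
     {Or, Abs, Mem, Comm :: 'a eqn} \<turnstile> vx \<or>\<^sub>s vx \<approx> vx \<and>
     {Or, Abs, Mem, Comm :: 'a eqn} \<turnstile> (vx \<and>\<^sub>s vy) \<and>\<^sub>s vz \<approx> vx \<and>\<^sub>s (vy \<and>\<^sub>s vz) \<and>
     {Or, Abs, Mem, Comm :: 'a eqn} \<turnstile> (vx \<or>\<^sub>s vy) \<or>\<^sub>s vz \<approx> vx \<or>\<^sub>s (vy \<or>\<^sub>s vz) \<and>
     {Or, Abs, Mem, Comm :: 'a eqn} \<turnstile> \<^bold>\<not> (\<^bold>\<not> vx) \<approx> vx \<and>
     {Or, Abs, Mem, Comm :: 'a eqn} \<turnstile> (vx \<or>\<^sub>s \<^bold>\<not> vx) \<and>\<^sub>s vy \<approx> vy \<and>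
     {Or, Abs, Mem, Comm :: 'a eqn} \<turnstile> vx \<and>\<^sub>s (vy \<or>\<^sub>s vz) \<approx> (vx \<and>\<^sub>s vy) \<or>\<^sub>s (vx \<and>\<^sub>s vz) \<and>
     ((\<exists>a b :: 'a. a \<noteq> b) \<longrightarrow>
        \<not> {Abs, Mem, Comm :: 'a eqn} \<turnstile> Or \<and>
        \<not> {Or, Mem, Comm :: 'a eqn} \<turnstile> Abs \<and>
        \<not> {Or, Abs, Comm :: 'a eqn} \<turnstile> Mem \<and>
        \<not> {Or, Abs, Mem :: 'a eqn} \<turnstile> Comm)"
  by (intro conjI impI Or_independent Abs_independent Mem_independent Comm_independent)
    (simp_all only: derivable_iff_static_term_eq static_term.conj_idem static_term.dual.conj_idem
      static_term.conj_assoc static_term.dual.conj_assoc static_term.neg_neg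
      static_term.excluded_middle_conj static_term.conj_disj_distrib)

end
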